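(* For any nonempty metric spaces $X$ and $Y$ we have $$d_{GH}(X,Y)=\frac12\inf\bigl\{\operatorname{dis}R: R\in\mathcal{R}^0(X,Y)\bigr\}.$$
   Context: For a metric space, $|xy|$ denotes the distance between points $x,y$. The Gromov--Hausdorff distance $d_{GH}(X,Y)\in[0,\infty]$ is the infimum of the numbers $r$ for which there exist a metric space $Z$ and subsets $X',Y'\subset Z$ isometric to $X$ and $Y$, respectively, whose Hausdorff distance in $Z$ is at most $r$. A correspondence between $X$ and $Y$ is a subset $R\subset X\times Y$ such that the restrictions to $R$ of the canonical projections to $X$ and to $Y$ are surjective; $\mathcal{R}(X,Y)$ is the set of all correspondences, partially ordered by inclusion. A correspondence is irreducible if it is minimal with respect to inclusion in $\mathcal{R}(X,Y)$; $\mathcal{R}^0(X,Y)$ is the set of irreducible correspondences. The distortion is $\operatorname{dis}R=\sup\bigl\{\bigl||xx'|-|yy'|\bigr|:(x,y)\in R,\ (x',y')\in R\bigr\}\in[0,\infty]$. *)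

theory Defs
  imports "HOL-Analysis.Analysis"
begin

definition isometric_spaces :: "'a metric \<Rightarrow> 'b metric \<Rightarrow> bool" where
  "isometric_spaces X Y \<longleftrightarrow>
     (\<exists>f. bij_betw f (mspace X) (mspace Y) \<and>
          (\<forall>x\<in>mspace X. \<forall>x'\<in>mspace X. mdist Y (f x) (f x') = mdist X x x'))"

definition hausdorff_distance :: "'a metric \<Rightarrow> 'a set \<Rightarrow> 'a set \<Rightarrow> ennreal" where
  "hausdorff_distance Z A B =
     max (SUP a\<in>A. INF b\<in>B. ennreal (mdist Z a b)) (SUP b\<in>B. INF a\<in>A. ennreal (mdist Z a b))"

text \<open>
  The ambient spaces \<open>Z\<close> are taken with carrier in the sum type \<open>'a + 'b\<close>. This is no restriction:
  only the subspace \<open>X' \<union> Y'\<close> of \<open>Z\<close> matters, and it injects into \<open>'a + 'b\<close>; see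
  \<open>gromov_hausdorff_distance_le\<close> and \<open>gromov_hausdorff_distance_eqI\<close> below.
\<close>

definition gromov_hausdorff_distance :: "'a metric \<Rightarrow> 'b metric \<Rightarrow> ennreal" where
  "gromov_hausdorff_distance X Y =
     Inf {ennreal r | r. 0 \<le> r \<and>
       (\<exists>(Z :: ('a + 'b) metric) X' Y'. X' \<subseteq> mspace Z \<and> Y' \<subseteq> mspace Z \<and>
          isometric_spaces X (submetric Z X') \<and> isometric_spaces Y (submetric Z Y') \<and>
          hausdorff_distance Z X' Y' \<le> ennreal r)}"

definition correspondences :: "'a metric \<Rightarrow> 'b metric \<Rightarrow> ('a \<times> 'b) set set" where
  "correspondences X Y =
     {R. R \<subseteq> mspace X \<times> mspace Y \<and> fst ` R = mspace X \<and> snd ` R = mspace Y}"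

definition irreducible_correspondences :: "'a metric \<Rightarrow> 'b metric \<Rightarrow> ('a \<times> 'b) set set" where
  "irreducible_correspondences X Y =
     {R \<in> correspondences X Y. \<forall>S\<in>correspondences X Y. S \<subseteq> R \<longrightarrow> S = R}"

definition distortion :: "'a metric \<Rightarrow> 'b metric \<Rightarrow> ('a \<times> 'b) set \<Rightarrow> ennreal" where
  "distortion X Y R =
     Sup {ennreal \<bar>mdist X x x' - mdist Y y y'\<bar> | x y x' y'. (x, y) \<in> R \<and> (x', y') \<in> R}"

lemma gromov_hausdorff_distance_le:
  fixes X :: "'a metric" and Y :: "'b metric" and Z :: "'z metric"
  assumes X': "X' \<subseteq> mspace Z" and Y': "Y' \<subseteq> mspace Z"
    and iX: "isometric_spaces X (submetric Z X')" and iY: "isometric_spaces Y (submetric Z Y')"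
  shows "gromov_hausdorff_distance X Y \<le> hausdorff_distance Z X' Y'"
proof (cases "hausdorff_distance Z X' Y' = \<infinity>")
  case False
  interpret Z: Metric_space "mspace Z" "mdist Z" by simp
  from iX X' obtain f where f: "bij_betw f (mspace X) X'"
    "\<And>x x'. x \<in> mspace X \<Longrightarrow> x' \<in> mspace X \<Longrightarrow> mdist Z (f x) (f x') = mdist X x x'"
    by (auto simp: isometric_spaces_def Int_absorb2)
  from iY Y' obtain g where g: "bij_betw g (mspace Y) Y'"
    "\<And>y y'. y \<in> mspace Y \<Longrightarrow> y' \<in> mspace Y \<Longrightarrow> mdist Z (g y) (g y') = mdist Y y y'"
    by (auto simp: isometric_spaces_def Int_absorb2)
  define U where "U = X' \<union> Y'"
  have U: "U \<subseteq> mspace Z" using X' Y' by (simp add: U_def)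
  define j :: "'z \<Rightarrow> 'a + 'b" where
    "j z = (if z \<in> X' then Inl (inv_into (mspace X) f z) else Inr (inv_into (mspace Y) g z))" for z
  have fi: "f (inv_into (mspace X) f z) = z" if "z \<in> X'" for z
    using f(1) that by (simp add: bij_betw_def f_inv_into_f)
  have gi: "g (inv_into (mspace Y) g z) = z" if "z \<in> Y'" for z
    using g(1) that by (simp add: bij_betw_def f_inv_into_f)
  have inj: "inj_on j U"
  proof (rule inj_on_inverseI)
    show "case_sum f g (j z) = z" if "z \<in> U" for z
      using that by (cases "z \<in> X'") (simp_all add: j_def U_def fi gi)
  qed
  define k where "k = inv_into U j"
  have kj: "k (j z) = z" if "z \<in> U" for z
    using inv_into_f_f[OF inj that] by (simp add: k_def)
  define W where "W = metric (j ` U, \<lambda>w w'. mdist Z (k w) (k w'))"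
  have MS: "Metric_space (j ` U) (\<lambda>w w'. mdist Z (k w) (k w'))"
  proof
    fix x y assume "x \<in> j ` U" "y \<in> j ` U"
    then show "mdist Z (k x) (k y) = 0 \<longleftrightarrow> x = y"
      using U by (auto simp: kj subset_iff)
  next
    fix x y z assume "x \<in> j ` U" "y \<in> j ` U" "z \<in> j ` U"
    then show "mdist Z (k x) (k z) \<le> mdist Z (k x) (k y) + mdist Z (k y) (k z)"
      using U by (auto simp: kj subset_iff intro!: Z.triangle)
  qed (auto simp: Z.commute)
  have W: "mspace W = j ` U" "mdist W = (\<lambda>w w'. mdist Z (k w) (k w'))"
    using Metric_space.mspace_metric[OF MS] Metric_space.mdist_metric[OF MS] by (auto simp: W_def)
  have XU: "X' \<subseteq> U" and YU: "Y' \<subseteq> U" by (auto simp: U_def)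
  have iso: "isometric_spaces A (submetric W (j ` A'))"
    if "bij_betw h (mspace A) A'" "A' \<subseteq> U"
       "\<And>x x'. x \<in> mspace A \<Longrightarrow> x' \<in> mspace A \<Longrightarrow> mdist Z (h x) (h x') = mdist A x x'"
    for A :: "'c metric" and h A'
    unfolding isometric_spaces_def
  proof (intro exI conjI ballI)
    have "bij_betw j A' (j ` A')"
      using inj that(2) by (meson bij_betw_imageI inj_on_subset)
    moreover have "mspace (submetric W (j ` A')) = j ` A'" using that(2) W by auto
    ultimately show "bij_betw (j \<circ> h) (mspace A) (mspace (submetric W (j ` A')))"
      using bij_betw_trans[OF that(1)] by metis
    fix x x' assume x: "x \<in> mspace A" "x' \<in> mspace A"
    then have "h x \<in> U" "h x' \<in> U" using that(1,2) by (auto simp: bij_betw_def)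
    then show "mdist (submetric W (j ` A')) ((j \<circ> h) x) ((j \<circ> h) x') = mdist A x x'"
      using that(3) x by (simp add: W kj)
  qed
  have d: "mdist W (j a) (j b) = mdist Z a b" if "a \<in> U" "b \<in> U" for a b
    using that by (simp add: W kj)
  have "(SUP a\<in>X'. INF b\<in>Y'. ennreal (mdist W (j a) (j b))) = (SUP a\<in>X'. INF b\<in>Y'. ennreal (mdist Z a b))"
    using XU YU by (intro SUP_cong INF_cong refl) (simp add: d subset_iff)
  moreover have "(SUP b\<in>Y'. INF a\<in>X'. ennreal (mdist W (j a) (j b))) = (SUP b\<in>Y'. INF a\<in>X'. ennreal (mdist Z a b))"
    using XU YU by (intro SUP_cong INF_cong refl) (simp add: d subset_iff)
  ultimately have "hausdorff_distance W (j ` X') (j ` Y') = hausdorff_distance Z X' Y'"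
    unfolding hausdorff_distance_def image_image by simp
  then have "\<exists>(W :: ('a + 'b) metric) X'' Y''. X'' \<subseteq> mspace W \<and> Y'' \<subseteq> mspace W \<and>
      isometric_spaces X (submetric W X'') \<and> isometric_spaces Y (submetric W Y'') \<and>
      hausdorff_distance W X'' Y'' \<le> hausdorff_distance Z X' Y'"
    using iso[OF f(1) XU f(2)] iso[OF g(1) YU g(2)] XU YU W(1)
    by (intro exI[of _ W] exI[of _ "j ` X'"] exI[of _ "j ` Y'"]) auto
  moreover obtain r where "0 \<le> r" "hausdorff_distance Z X' Y' = ennreal r"
    using False by (cases "hausdorff_distance Z X' Y'") auto
  ultimately show ?thesis
    unfolding gromov_hausdorff_distance_def by (auto intro!: Inf_lower)
qed simp

lemma gromov_hausdorff_distance_eqI: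
  fixes X :: "'a metric" and Y :: "'b metric" and e :: "'a + 'b \<Rightarrow> 'z"
  assumes e: "inj e"
  shows "gromov_hausdorff_distance X Y =
     Inf {ennreal r | r. 0 \<le> r \<and>
       (\<exists>(Z :: 'z metric) X' Y'. X' \<subseteq> mspace Z \<and> Y' \<subseteq> mspace Z \<and>
          isometric_spaces X (submetric Z X') \<and> isometric_spaces Y (submetric Z Y') \<and>
          hausdorff_distance Z X' Y' \<le> ennreal r)}" (is "_ = Inf ?S")
proof (rule antisym)
  show "gromov_hausdorff_distance X Y \<le> Inf ?S"
    by (auto intro!: Inf_greatest intro: order_trans[OF gromov_hausdorff_distance_le])
  show "Inf ?S \<le> gromov_hausdorff_distance X Y"
    unfolding gromov_hausdorff_distance_def
  proof (rule Inf_superset_mono, clarify)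
    fix r :: real and Z :: "('a + 'b) metric" and X' Y'
    assume r: "0 \<le> r" and X': "X' \<subseteq> mspace Z" and Y': "Y' \<subseteq> mspace Z"
      and iX: "isometric_spaces X (submetric Z X')" and iY: "isometric_spaces Y (submetric Z Y')"
      and h: "hausdorff_distance Z X' Y' \<le> ennreal r"
    interpret Z: Metric_space "mspace Z" "mdist Z" by simp
    define W where "W = metric (e ` mspace Z, \<lambda>w w'. mdist Z (inv e w) (inv e w'))"
    have MS: "Metric_space (e ` mspace Z) (\<lambda>w w'. mdist Z (inv e w) (inv e w'))"
      by unfold_locales (auto simp: e Z.commute inj_eq intro!: Z.triangle)
    have W: "mspace W = e ` mspace Z" "mdist W = (\<lambda>w w'. mdist Z (inv e w) (inv e w'))"
      using Metric_space.mspace_metric[OF MS] Metric_space.mdist_metric[OF MS] by (auto simp: W_def)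
    have iso: "isometric_spaces A (submetric W (e ` A'))"
      if iA: "isometric_spaces A (submetric Z A')" and A': "A' \<subseteq> mspace Z"
      for A :: "'c metric" and A'
    proof -
      obtain f where f: "bij_betw f (mspace A) A'"
        "\<And>x x'. x \<in> mspace A \<Longrightarrow> x' \<in> mspace A \<Longrightarrow> mdist Z (f x) (f x') = mdist A x x'"
        using iA A' by (auto simp: isometric_spaces_def Int_absorb2)
      have "bij_betw e A' (e ` A')"
        using e by (meson bij_betw_imageI inj_on_subset subset_UNIV)
      moreover have "mspace (submetric W (e ` A')) = e ` A'" using A' W by auto
      ultimately have "bij_betw (e \<circ> f) (mspace A) (mspace (submetric W (e ` A')))"
        using bij_betw_trans[OF f(1)] by metis
      then show ?thesis
        using f(2) e unfolding isometric_spaces_def by (intro exI[of _ "e \<circ> f"]) (simp add: W)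
    qed
    have "hausdorff_distance W (e ` X') (e ` Y') = hausdorff_distance Z X' Y'"
      by (simp add: hausdorff_distance_def image_image W e)
    then show "\<exists>r'. ennreal r = ennreal r' \<and> 0 \<le> r' \<and>
       (\<exists>(Z :: 'z metric) X' Y'. X' \<subseteq> mspace Z \<and> Y' \<subseteq> mspace Z \<and>
          isometric_spaces X (submetric Z X') \<and> isometric_spaces Y (submetric Z Y') \<and>
          hausdorff_distance Z X' Y' \<le> ennreal r')"
      using r h iso[OF iX X'] iso[OF iY Y'] X' Y' W(1)
      by (intro exI[of _ r] conjI refl exI[of _ W] exI[of _ "e ` X'"] exI[of _ "e ` Y'"]) auto
  qed
qed

end

theory Submission
  imports Defs
begin

text \<open>
  The Gromov--Hausdorff distance is half the infimum of the distortions of all correspondences: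
  points of two sets at Hausdorff distance less than \<open>s\<close> can be matched at distance less than
  \<open>s\<close>, and such a matching changes distances by at most \<open>2 * s\<close>
  (\<open>hausdorff_distance_correspondence\<close>); conversely, a correspondence of distortion at most
  \<open>2 * r\<close> makes it possible to glue both spaces into one metric space, corresponding points
  being put at distance \<open>r\<close> (\<open>gromov_hausdorff_distance_le_gluing\<close>).

  Restricting the infimum to irreducible correspondences does not change it, because the distortion
  is monotone and every correspondence contains an irreducible one
  (\<open>irreducible_subcorrespondence\<close>). The latter is not a matter of Zorn's lemma: the
  intersection of a decreasing chain of correspondences can leave a point without partner. Instead,
  a correspondence is seen as a bipartite graph without isolated vertices. Its irreducible
  subcorrespondences are its spanning star forests. Such a forest arises from a spanning forest of
  trees of height at most two, which is obtained by choosing a partner for each point of either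
  space, by cutting superfluous edges at the roots.
\<close>

section \<open>Irreducible correspondences\<close>

lemma irreducible_correspondenceI:
  assumes S: "S \<in> correspondences X Y"
    and end_point: "\<And>x y. (x, y) \<in> S \<Longrightarrow>
      (\<forall>y'. (x, y') \<in> S \<longrightarrow> y' = y) \<or> (\<forall>x'. (x', y) \<in> S \<longrightarrow> x' = x)"
  shows "S \<in> irreducible_correspondences X Y"
proof -
  have "S \<subseteq> T" if T: "T \<in> correspondences X Y" "T \<subseteq> S" for T
  proof clarify
    fix x y assume xy: "(x, y) \<in> S"
    then have "x \<in> fst ` T" "y \<in> snd ` T"
      using S T(1) by (auto simp: correspondences_def)
    then obtain y' x' where "(x, y') \<in> T" "(x', y) \<in> T" by force
    then show "(x, y) \<in> T" using end_point[OF xy] T(2) by blast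
  qed
  then show ?thesis using S by (auto simp: irreducible_correspondences_def)
qed

text \<open>
  Choose partners \<open>f x\<close> of all \<open>x\<close>, and partners \<open>g y\<close> of those \<open>y\<close> which are not of the form
  \<open>f x\<close>. The chosen edges form trees of height at most two, with the roots in the range of \<open>f\<close>,
  their children in \<open>X\<close>, and the remaining points of \<open>Y\<close> as grandchildren. A child that has
  children itself (that is, a point of the range \<open>A\<close> of \<open>g\<close>) is cut from its root and becomes the
  centre of a star. If this happens to all children of a root, then exactly one of the cut edges
  has to be retained, which makes the root one more leaf of that child's star.
\<close>

lemma irreducible_subcorrespondence:
  assumes R: "R \<in> correspondences X Y"
  obtains S where "S \<in> irreducible_correspondences X Y" "S \<subseteq> R"
proof -
  have RX: "\<exists>y. (x, y) \<in> R" if "x \<in> mspace X" for x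
    using R that by (force simp: correspondences_def)
  have RY: "\<exists>x. (x, y) \<in> R" if "y \<in> mspace Y" for y
    using R that by (force simp: correspondences_def)
  have R_sub: "R \<subseteq> mspace X \<times> mspace Y" using R by (simp add: correspondences_def)
  obtain f where f: "\<And>x. x \<in> mspace X \<Longrightarrow> (x, f x) \<in> R" using RX by metis
  obtain g where g: "\<And>y. y \<in> mspace Y \<Longrightarrow> (g y, y) \<in> R" using RY by metis
  define Y0 where "Y0 = mspace Y - f ` mspace X"
  define A where "A = g ` Y0"
  \<comment> \<open>For each root, one child whose edge is retained; it is a leaf of the tree if possible.\<close>
  have "\<exists>x. x \<in> mspace X \<and> f x = y \<and> (x \<in> A \<longrightarrow> (\<forall>x'\<in>mspace X. f x' = y \<longrightarrow> x' \<in> A))"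
    if "y \<in> f ` mspace X" for y
    using that by (cases "\<exists>x\<in>mspace X. f x = y \<and> x \<notin> A") auto
  then obtain p where p: "\<And>y. y \<in> f ` mspace X \<Longrightarrow> p y \<in> mspace X"
      "\<And>y. y \<in> f ` mspace X \<Longrightarrow> f (p y) = y"
      "\<And>y x'. y \<in> f ` mspace X \<Longrightarrow> p y \<in> A \<Longrightarrow> x' \<in> mspace X \<Longrightarrow> f x' = y \<Longrightarrow> x' \<in> A"
    by metis
  define S where "S = {(g y, y) | y. y \<in> Y0} \<union> {(x, f x) | x. x \<in> mspace X - A}
    \<union> {(p y, y) | y. y \<in> f ` mspace X}"
  have S_iff: "(x, y) \<in> S \<longleftrightarrow> (y \<in> Y0 \<and> x = g y) \<or> (x \<in> mspace X - A \<and> y = f x)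
      \<or> (y \<in> f ` mspace X \<and> x = p y)" for x y
    by (auto simp: S_def)
  have S_R: "S \<subseteq> R"
  proof clarify
    fix x y assume "(x, y) \<in> S"
    then consider "y \<in> mspace Y" "x = g y" | "x \<in> mspace X" "y = f x"
      | "y \<in> f ` mspace X" "x = p y"
      unfolding S_iff Y0_def by blast
    then show "(x, y) \<in> R"
    proof cases
      case 3
      then show ?thesis using f[OF p(1)] p(2) by metis
    qed (auto simp: f g)
  qed
  have "x \<in> fst ` S" if "x \<in> mspace X" for x
  proof -
    have "\<exists>y. (x, y) \<in> S"
      using that by (cases "x \<in> A") (auto simp: S_iff A_def)
    then show ?thesis by force
  qed
  moreover have "y \<in> snd ` S" if "y \<in> mspace Y" for y
  proof -
    have "\<exists>x. (x, y) \<in> S"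
      using that by (cases "y \<in> Y0") (auto simp: S_iff Y0_def)
    then show ?thesis by force
  qed
  ultimately have "S \<in> correspondences X Y"
    using S_R R_sub by (fastforce simp: correspondences_def)
  then have "S \<in> irreducible_correspondences X Y"
  proof (rule irreducible_correspondenceI)
    fix x y assume "(x, y) \<in> S"
    then consider (grandchild) "y \<in> Y0" | (leaf) "x \<in> mspace X - A" "y = f x"
      | (retained) "y \<in> f ` mspace X" "x = p y" "p y \<in> A"
      unfolding S_iff using p(1,2) by (metis DiffI)
    then show "(\<forall>y'. (x, y') \<in> S \<longrightarrow> y' = y) \<or> (\<forall>x'. (x', y) \<in> S \<longrightarrow> x' = x)"
    proof cases
      case grandchild
      then have "x' = g y" if "(x', y) \<in> S" for x'
        using that unfolding S_iff Y0_def by auto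
      then show ?thesis using \<open>(x, y) \<in> S\<close> by blast
    next
      case leaf
      then have "y' = y" if "(x, y') \<in> S" for y'
        using that p(2)[of y'] by (auto simp: S_iff A_def)
      then show ?thesis by blast
    next
      case retained
      then have "y \<notin> Y0" by (simp add: Y0_def)
      then have "x' = x" if "(x', y) \<in> S" for x'
        using that p(3)[OF retained(1,3), of x'] retained(2) by (auto simp: S_iff)
      then show ?thesis by blast
    qed
  qed
  then show thesis using S_R by (rule that)
qed

section \<open>Distortion and Hausdorff distance\<close>

lemma distortion_le_iff:
  assumes "0 \<le> c"
  shows "distortion X Y R \<le> ennreal c \<longleftrightarrow>
    (\<forall>(x, y)\<in>R. \<forall>(x', y')\<in>R. \<bar>mdist X x x' - mdist Y y y'\<bar> \<le> c)"
  unfolding distortion_def Sup_le_iff using assms by (fastforce simp: ennreal_le_iff)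

lemma distortion_mono:
  assumes "S \<subseteq> R"
  shows "distortion X Y S \<le> distortion X Y R"
  unfolding distortion_def using assms by (intro Sup_subset_mono) blast

lemma hausdorff_distance_correspondence:
  assumes X': "X' \<subseteq> mspace Z" and Y': "Y' \<subseteq> mspace Z"
    and iX: "isometric_spaces X (submetric Z X')" and iY: "isometric_spaces Y (submetric Z Y')"
    and s: "hausdorff_distance Z X' Y' < ennreal s"
  obtains R where "R \<in> correspondences X Y" "distortion X Y R \<le> ennreal (2 * s)"
proof -
  have s_pos: "0 < s" using s by (cases "0 < s") (auto simp: ennreal_neg)
  from iX X' obtain f where f: "bij_betw f (mspace X) X'"
    "\<And>x x'. x \<in> mspace X \<Longrightarrow> x' \<in> mspace X \<Longrightarrow> mdist Z (f x) (f x') = mdist X x x'"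
    by (auto simp: isometric_spaces_def Int_absorb2)
  from iY Y' obtain g where g: "bij_betw g (mspace Y) Y'"
    "\<And>y y'. y \<in> mspace Y \<Longrightarrow> y' \<in> mspace Y \<Longrightarrow> mdist Z (g y) (g y') = mdist Y y y'"
    by (auto simp: isometric_spaces_def Int_absorb2)
  have fX: "f ` mspace X = X'" and gY: "g ` mspace Y = Y'"
    using f(1) g(1) by (auto simp: bij_betw_def)
  define R where
    "R = {(x, y). x \<in> mspace X \<and> y \<in> mspace Y \<and> mdist Z (f x) (g y) < s}"
  have "\<exists>y. (x, y) \<in> R" if "x \<in> mspace X" for x
  proof -
    have "(INF b\<in>Y'. ennreal (mdist Z (f x) b)) \<le> hausdorff_distance Z X' Y'"
      unfolding hausdorff_distance_def using that fX
      by (intro max.coboundedI1 SUP_upper) blast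
    then have "(INF b\<in>Y'. ennreal (mdist Z (f x) b)) < ennreal s" using s by simp
    then show ?thesis
      using that gY s_pos by (auto simp: R_def INF_less_iff ennreal_less_iff)
  qed
  moreover have "\<exists>x. (x, y) \<in> R" if "y \<in> mspace Y" for y
  proof -
    have "(INF a\<in>X'. ennreal (mdist Z a (g y))) \<le> hausdorff_distance Z X' Y'"
      unfolding hausdorff_distance_def using that gY
      by (intro max.coboundedI2 SUP_upper) blast
    then have "(INF a\<in>X'. ennreal (mdist Z a (g y))) < ennreal s" using s by simp
    then show ?thesis
      using that fX s_pos by (auto simp: R_def INF_less_iff ennreal_less_iff)
  qed
  ultimately have "R \<in> correspondences X Y"
    by (force simp: correspondences_def R_def)
  moreover have "\<bar>mdist X x x' - mdist Y y y'\<bar> \<le> 2 * s" if "(x, y) \<in> R" "(x', y') \<in> R" for x y x' y'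
  proof -
    have in_spaces: "x \<in> mspace X" "x' \<in> mspace X" "y \<in> mspace Y" "y' \<in> mspace Y"
      and near: "mdist Z (f x) (g y) < s" "mdist Z (f x') (g y') < s"
      using that by (auto simp: R_def)
    then have in_Z: "f x \<in> mspace Z" "f x' \<in> mspace Z" "g y \<in> mspace Z" "g y' \<in> mspace Z"
      using fX gY X' Y' by auto
    have "mdist Z (f x) (f x') \<le> mdist Z (f x) (g y) + (mdist Z (g y) (g y') + mdist Z (g y') (f x'))"
      using mdist_triangle[of "f x" Z "g y" "f x'"] mdist_triangle[of "g y" Z "g y'" "f x'"] in_Z
      by simp
    moreover
    have "mdist Z (g y) (g y') \<le> mdist Z (g y) (f x) + (mdist Z (f x) (f x') + mdist Z (f x') (g y'))"
      using mdist_triangle[of "g y" Z "f x" "g y'"] mdist_triangle[of "f x" Z "f x'" "g y'"] in_Z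
      by simp
    ultimately show ?thesis
      using near f(2) g(2) in_spaces mdist_commute[of Z "f x" "g y"] mdist_commute[of Z "f x'" "g y'"]
      by (simp add: abs_le_iff)
  qed
  then have "distortion X Y R \<le> ennreal (2 * s)"
    using s_pos by (subst distortion_le_iff) auto
  ultimately show thesis by (rule that)
qed

section \<open>Gluing two spaces along a correspondence\<close>

lemma mdist_self: "x \<in> mspace X \<Longrightarrow> mdist X x x = 0"
  by simp

text \<open>
  The least total length of a path from \<open>x\<close> to \<open>y\<close> that may jump between the spaces, at no cost,
  once, at a pair of corresponding points.
\<close>

definition jump_dist :: "'a metric \<Rightarrow> 'b metric \<Rightarrow> ('a \<times> 'b) set \<Rightarrow> 'a \<Rightarrow> 'b \<Rightarrow> real" where
  "jump_dist X Y R x y = (INF (u, v)\<in>R. mdist X x u + mdist Y v y)"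

fun glue_dist :: "'a metric \<Rightarrow> 'b metric \<Rightarrow> ('a \<times> 'b) set \<Rightarrow> real \<Rightarrow> 'a + 'b \<Rightarrow> 'a + 'b \<Rightarrow> real" where
  "glue_dist X Y R r (Inl x) (Inl x') = mdist X x x'"
| "glue_dist X Y R r (Inr y) (Inr y') = mdist Y y y'"
| "glue_dist X Y R r (Inl x) (Inr y) = jump_dist X Y R x y + r"
| "glue_dist X Y R r (Inr y) (Inl x) = jump_dist X Y R x y + r"

lemma jump_dist_le:
  assumes "(u, v) \<in> R"
  shows "jump_dist X Y R x y \<le> mdist X x u + mdist Y v y"
proof -
  have "bdd_below ((\<lambda>(u, v). mdist X x u + mdist Y v y) ` R)"
    by (rule bdd_belowI[of _ 0]) auto
  from cINF_lower[OF this assms] show ?thesis by (simp add: jump_dist_def)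
qed

lemma jump_dist_greatest:
  assumes "R \<noteq> {}" and "\<And>u v. (u, v) \<in> R \<Longrightarrow> c \<le> mdist X x u + mdist Y v y"
  shows "c \<le> jump_dist X Y R x y"
  unfolding jump_dist_def using assms by (intro cINF_greatest) auto

lemma jump_dist_triangle:
  assumes "R \<noteq> {}" and R: "R \<subseteq> mspace X \<times> mspace Y"
    and x: "x \<in> mspace X" "x' \<in> mspace X" and y: "y \<in> mspace Y" "y' \<in> mspace Y"
  shows "jump_dist X Y R x y \<le> mdist X x x' + (jump_dist X Y R x' y' + mdist Y y' y)"
proof -
  have "jump_dist X Y R x y - mdist X x x' - mdist Y y' y \<le> jump_dist X Y R x' y'"
  proof (rule jump_dist_greatest[OF assms(1)])
    fix u v assume uv: "(u, v) \<in> R"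
    then have "u \<in> mspace X" "v \<in> mspace Y" using R by auto
    then show "jump_dist X Y R x y - mdist X x x' - mdist Y y' y \<le> mdist X x' u + mdist Y v y'"
      using jump_dist_le[OF uv, of X Y x y] mdist_triangle[of x X x' u] mdist_triangle[of v Y y' y] x y
      by simp
  qed
  then show ?thesis by simp
qed

text \<open>
  A detour through the other space uses two jumps. It shortens the way by at most the distortion
  of the correspondence, so paying half of the distortion for each jump makes up for it.
\<close>

lemma jump_dist_detour:
  assumes "R \<noteq> {}" and R: "R \<subseteq> mspace X \<times> mspace Y"
    and dis: "\<And>u v u' v'. (u, v) \<in> R \<Longrightarrow> (u', v') \<in> R \<Longrightarrow> \<bar>mdist X u u' - mdist Y v v'\<bar> \<le> 2 * r"
  shows "x \<in> mspace X \<Longrightarrow> x' \<in> mspace X \<Longrightarrow> y \<in> mspace Y \<Longrightarrow>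
      mdist X x x' \<le> jump_dist X Y R x y + jump_dist X Y R x' y + 2 * r"
    and "x \<in> mspace X \<Longrightarrow> y \<in> mspace Y \<Longrightarrow> y' \<in> mspace Y \<Longrightarrow>
      mdist Y y y' \<le> jump_dist X Y R x y + jump_dist X Y R x y' + 2 * r"
proof -
  have twice: "c \<le> jump_dist X Y R x y + jump_dist X Y R x' y' + 2 * r"
    if bound: "\<And>u v u' v'. (u, v) \<in> R \<Longrightarrow> (u', v') \<in> R \<Longrightarrow>
      c \<le> (mdist X x u + mdist Y v y) + (mdist X x' u' + mdist Y v' y') + 2 * r" for c x x' y y'
  proof -
    have "c - 2 * r - jump_dist X Y R x y \<le> jump_dist X Y R x' y'"
    proof (rule jump_dist_greatest[OF assms(1)])
      fix u' v' assume uv': "(u', v') \<in> R"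
      have "c - 2 * r - (mdist X x' u' + mdist Y v' y') \<le> jump_dist X Y R x y"
        using bound[OF _ uv'] by (intro jump_dist_greatest[OF assms(1)]) fastforce
      then show "c - 2 * r - jump_dist X Y R x y \<le> mdist X x' u' + mdist Y v' y'" by simp
    qed
    then show ?thesis by simp
  qed
  show "mdist X x x' \<le> jump_dist X Y R x y + jump_dist X Y R x' y + 2 * r"
    if x: "x \<in> mspace X" "x' \<in> mspace X" and y: "y \<in> mspace Y"
  proof (rule twice)
    fix u v u' v' assume uv: "(u, v) \<in> R" "(u', v') \<in> R"
    then have "u \<in> mspace X" "v \<in> mspace Y" "u' \<in> mspace X" "v' \<in> mspace Y" using R by auto
    then have "mdist X x x' \<le> mdist X x u + (mdist X u u' + mdist X x' u')"
      and "mdist Y v v' \<le> mdist Y v y + mdist Y v' y"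
      using mdist_triangle[of x X u x'] mdist_triangle[of u X u' x'] mdist_triangle[of v Y y v'] x y
      by (simp_all add: mdist_commute)
    then show "mdist X x x' \<le> (mdist X x u + mdist Y v y) + (mdist X x' u' + mdist Y v' y) + 2 * r"
      using dis[OF uv] by linarith
  qed
  show "mdist Y y y' \<le> jump_dist X Y R x y + jump_dist X Y R x y' + 2 * r"
    if x: "x \<in> mspace X" and y: "y \<in> mspace Y" "y' \<in> mspace Y"
  proof (rule twice)
    fix u v u' v' assume uv: "(u, v) \<in> R" "(u', v') \<in> R"
    then have "u \<in> mspace X" "v \<in> mspace Y" "u' \<in> mspace X" "v' \<in> mspace Y" using R by auto
    then have "mdist Y y y' \<le> mdist Y v y + (mdist Y v v' + mdist Y v' y')"
      and "mdist X u u' \<le> mdist X x u + mdist X x u'"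
      using mdist_triangle[of y Y v y'] mdist_triangle[of v Y v' y'] mdist_triangle[of u X x u'] x y
      by (simp_all add: mdist_commute)
    then show "mdist Y y y' \<le> (mdist X x u + mdist Y v y) + (mdist X x u' + mdist Y v' y') + 2 * r"
      using dis[OF uv] by linarith
  qed
qed

lemma Metric_space_glue_dist:
  assumes "R \<noteq> {}" and R: "R \<subseteq> mspace X \<times> mspace Y" and r: "0 < r"
    and dis: "\<And>u v u' v'. (u, v) \<in> R \<Longrightarrow> (u', v') \<in> R \<Longrightarrow> \<bar>mdist X u u' - mdist Y v v'\<bar> \<le> 2 * r"
  shows "Metric_space (mspace X <+> mspace Y) (glue_dist X Y R r)"
proof
  have nonneg: "0 \<le> jump_dist X Y R x y" for x y
    by (rule jump_dist_greatest[OF assms(1)]) simp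
  show "0 \<le> glue_dist X Y R r p q" for p q
    using nonneg r by (cases p; cases q) (auto simp: less_imp_le)
  show "glue_dist X Y R r p q = glue_dist X Y R r q p" for p q
    by (cases p; cases q) (auto simp: mdist_commute)
  show "glue_dist X Y R r p q = 0 \<longleftrightarrow> p = q"
    if "p \<in> mspace X <+> mspace Y" "q \<in> mspace X <+> mspace Y" for p q
  proof -
    have "jump_dist X Y R x y + r \<noteq> 0" for x y using nonneg[of x y] r by linarith
    then show ?thesis using that by auto
  qed
  show "glue_dist X Y R r p s \<le> glue_dist X Y R r p q + glue_dist X Y R r q s"
    if "p \<in> mspace X <+> mspace Y" "q \<in> mspace X <+> mspace Y" "s \<in> mspace X <+> mspace Y" for p q s
  proof -
    note detour = jump_dist_detour[OF assms(1) R dis]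
    have left: "jump_dist X Y R x y \<le> mdist X x x' + jump_dist X Y R x' y"
      if "x \<in> mspace X" "x' \<in> mspace X" "y \<in> mspace Y" for x x' y
      using jump_dist_triangle[OF assms(1) R that(1,2,3,3)] that by (simp add: mdist_self)
    have right: "jump_dist X Y R x y \<le> jump_dist X Y R x y' + mdist Y y' y"
      if "x \<in> mspace X" "y \<in> mspace Y" "y' \<in> mspace Y" for x y y'
      using jump_dist_triangle[OF assms(1) R that(1,1,2,3)] that by (simp add: mdist_self)
    show ?thesis
    proof (cases p; cases q; cases s)
      fix x x' x'' assume "p = Inl x" "q = Inl x'" "s = Inl x''"
      then show ?thesis using that mdist_triangle[of x X x' x''] by (simp add: Plus_def image_iff)
    next
      fix y y' y'' assume "p = Inr y" "q = Inr y'" "s = Inr y''"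
      then show ?thesis using that mdist_triangle[of y Y y' y''] by (simp add: Plus_def image_iff)
    next
      fix x y x' assume "p = Inl x" "q = Inr y" "s = Inl x'"
      then show ?thesis using that detour(1)[of x x' y] by (simp add: Plus_def image_iff)
    next
      fix y x y' assume "p = Inr y" "q = Inl x" "s = Inr y'"
      then show ?thesis using that detour(2)[of x y y'] by (simp add: Plus_def image_iff)
    next
      fix x x' y assume "p = Inl x" "q = Inl x'" "s = Inr y"
      then show ?thesis using that left[of x x' y] by (simp add: Plus_def image_iff)
    next
      fix y x x' assume "p = Inr y" "q = Inl x" "s = Inl x'"
      then show ?thesis using that left[of x' x y] by (simp add: Plus_def image_iff mdist_commute)
    next
      fix x y y' assume "p = Inl x" "q = Inr y" "s = Inr y'"
      then show ?thesis using that right[of x y' y] by (simp add: Plus_def image_iff)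
    next
      fix y y' x assume "p = Inr y" "q = Inr y'" "s = Inl x"
      then show ?thesis using that right[of x y y'] by (simp add: Plus_def image_iff mdist_commute)
    qed
  qed
qed

text \<open>
  The price \<open>r\<close> of a jump must be positive to keep the two copies disjoint, even if the
  correspondence preserves all distances.
\<close>

lemma gromov_hausdorff_distance_le_gluing:
  fixes X :: "'a metric" and Y :: "'b metric"
  assumes R: "R \<in> correspondences X Y" "R \<noteq> {}" and r: "0 < r"
    and dis: "distortion X Y R \<le> ennreal (2 * r)"
  shows "gromov_hausdorff_distance X Y \<le> ennreal r"
proof -
  have R_sub: "R \<subseteq> mspace X \<times> mspace Y" using R(1) by (simp add: correspondences_def)
  have "\<bar>mdist X u u' - mdist Y v v'\<bar> \<le> 2 * r" if "(u, v) \<in> R" "(u', v') \<in> R" for u v u' v'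
    using dis r that by (subst (asm) distortion_le_iff) auto
  note MS = Metric_space_glue_dist[OF R(2) R_sub r this]
  define Z where "Z = metric (mspace X <+> mspace Y, glue_dist X Y R r)"
  have Z: "mspace Z = mspace X <+> mspace Y" "mdist Z = glue_dist X Y R r"
    using Metric_space.mspace_metric[OF MS] Metric_space.mdist_metric[OF MS] by (simp_all add: Z_def)
  have iX: "isometric_spaces X (submetric Z (Inl ` mspace X))"
    unfolding isometric_spaces_def
    by (rule exI[of _ Inl]) (auto simp: Z bij_betw_def)
  have iY: "isometric_spaces Y (submetric Z (Inr ` mspace Y))"
    unfolding isometric_spaces_def
    by (rule exI[of _ Inr]) (auto simp: Z bij_betw_def)
  have near: "mdist Z (Inl x) (Inr y) \<le> r" if "(x, y) \<in> R" for x y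
  proof -
    have "x \<in> mspace X" "y \<in> mspace Y" using R_sub that by auto
    then show ?thesis using jump_dist_le[OF that, of X Y x y] by (simp add: Z mdist_self)
  qed
  have "(INF b\<in>Inr ` mspace Y. ennreal (mdist Z a b)) \<le> ennreal r" if a: "a \<in> Inl ` mspace X" for a
  proof -
    obtain x where "a = Inl x" "x \<in> fst ` R" using a R(1) by (auto simp: correspondences_def)
    then obtain y where "(x, y) \<in> R" by force
    then show ?thesis
      using near R_sub \<open>a = Inl x\<close> by (intro INF_lower2[of "Inr y"]) (auto intro: ennreal_leI)
  qed
  moreover
  have "(INF a\<in>Inl ` mspace X. ennreal (mdist Z a b)) \<le> ennreal r" if b: "b \<in> Inr ` mspace Y" for b
  proof -
    obtain y where "b = Inr y" "y \<in> snd ` R" using b R(1) by (auto simp: correspondences_def)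
    then obtain x where "(x, y) \<in> R" by force
    then show ?thesis
      using near R_sub \<open>b = Inr y\<close> by (intro INF_lower2[of "Inl x"]) (auto intro: ennreal_leI)
  qed
  ultimately have "hausdorff_distance Z (Inl ` mspace X) (Inr ` mspace Y) \<le> ennreal r"
    unfolding hausdorff_distance_def by (intro max.boundedI SUP_least)
  moreover have "Inl ` mspace X \<subseteq> mspace Z" "Inr ` mspace Y \<subseteq> mspace Z" by (auto simp: Z)
  then have "gromov_hausdorff_distance X Y
      \<le> hausdorff_distance Z (Inl ` mspace X) (Inr ` mspace Y)"
    using iX iY by (rule gromov_hausdorff_distance_le)
  ultimately show ?thesis by (rule order_trans[rotated])
qed

section \<open>The Gromov--Hausdorff distance by irreducible correspondences\<close>

lemma ennreal_half:
  assumes "0 \<le> r"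
  shows "1 / 2 * a \<le> ennreal r \<longleftrightarrow> a \<le> ennreal (2 * r)"
    and "1 / 2 * a < ennreal r \<longleftrightarrow> a < ennreal (2 * r)"
proof -
  have half: "1 / 2 * ennreal c = ennreal (c / 2)" if "0 \<le> c" for c
    using that by (simp add: ennreal_divide_times divide_ennreal[symmetric])
  show "1 / 2 * a \<le> ennreal r \<longleftrightarrow> a \<le> ennreal (2 * r)"
    using assms by (cases a) (auto simp: half ennreal_mult_top ennreal_divide_eq_0_iff top_unique)
  show "1 / 2 * a < ennreal r \<longleftrightarrow> a < ennreal (2 * r)"
    using assms by (cases a) (auto simp: half ennreal_mult_top ennreal_divide_eq_0_iff ennreal_less_iff)
qed

theorem corollary2p9:
  fixes X :: "'a metric" and Y :: "'b metric"
  assumes "mspace X \<noteq> {}" and "mspace Y \<noteq> {}"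
  shows "gromov_hausdorff_distance X Y =
    1 / 2 * (INF R\<in>irreducible_correspondences X Y. distortion X Y R)"
proof (rule antisym)
  let ?I = "INF R\<in>irreducible_correspondences X Y. distortion X Y R"
  show "gromov_hausdorff_distance X Y \<le> 1 / 2 * ?I"
    \<comment> \<open>Bounds strictly above the right-hand side are positive, as gluing demands, and exceed half of
      the distortion of some correspondence.\<close>
  proof (rule dense_ge)
    fix b assume b: "1 / 2 * ?I < b"
    show "gromov_hausdorff_distance X Y \<le> b"
    proof (cases b)
      case (real r)
      have "0 < r" using b real by (cases "r = 0") auto
      then have "?I < ennreal (2 * r)" using b real by (simp only: ennreal_half(2))
      then obtain R where R: "R \<in> irreducible_correspondences X Y"
          "distortion X Y R < ennreal (2 * r)"
        by (auto simp: INF_less_iff)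
      then have "R \<in> correspondences X Y" by (simp add: irreducible_correspondences_def)
      moreover from this have "R \<noteq> {}" using assms(1) by (auto simp: correspondences_def)
      ultimately show ?thesis
        unfolding real(2) using \<open>0 < r\<close> less_imp_le[OF R(2)] by (rule gromov_hausdorff_distance_le_gluing)
    qed simp
  qed
  show "1 / 2 * ?I \<le> gromov_hausdorff_distance X Y"
    unfolding gromov_hausdorff_distance_def
  proof (rule Inf_greatest, clarify)
    fix r :: real and Z :: "('a + 'b) metric" and X' Y'
    assume r: "0 \<le> r" and X': "X' \<subseteq> mspace Z" and Y': "Y' \<subseteq> mspace Z"
      and iX: "isometric_spaces X (submetric Z X')" and iY: "isometric_spaces Y (submetric Z Y')"
      and h: "hausdorff_distance Z X' Y' \<le> ennreal r"
    show "1 / 2 * ?I \<le> ennreal r"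
    proof (rule ennreal_le_epsilon)
      fix e :: real assume "0 < e"
      then have "hausdorff_distance Z X' Y' < ennreal (r + e)"
        using r by (intro le_less_trans[OF h]) (simp add: ennreal_less_iff)
      then obtain R where R: "R \<in> correspondences X Y" "distortion X Y R \<le> ennreal (2 * (r + e))"
        using hausdorff_distance_correspondence[OF X' Y' iX iY] by blast
      obtain S where S: "S \<in> irreducible_correspondences X Y" "S \<subseteq> R"
        using irreducible_subcorrespondence[OF R(1)] .
      have "?I \<le> distortion X Y S" using S(1) by (rule INF_lower)
      also have "\<dots> \<le> distortion X Y R" using S(2) by (rule distortion_mono)
      also have "\<dots> \<le> ennreal (2 * (r + e))" by (rule R(2))
      finally have "1 / 2 * ?I \<le> ennreal (r + e)" using r \<open>0 < e\<close> by (subst ennreal_half(1)) auto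
      then show "1 / 2 * ?I \<le> ennreal r + ennreal e" using r \<open>0 < e\<close> by simp
    qed
  qed
qed

end
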